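(* Given any positive integer $m$ and any $\epsilon>0$, there exists an integer $n=n(m,\epsilon)>m$ such that $$d_{\mathrm{GH}}(\mathbb{S}^m,\mathbb{S}^n)\geq \frac{\pi}{2}-\epsilon.$$
   Context: For an integer $m\ge 0$, $\mathbb{S}^m=\{x\in\mathbb{R}^{m+1}:\|x\|=1\}$ is the unit sphere with the geodesic distance $d_{\mathbb{S}^m}(x,x')=\arccos\langle x,x'\rangle$. The Gromov-Hausdorff distance between bounded metric spaces $X,Y$ is $d_{\mathrm{GH}}(X,Y)=\inf d_{\mathrm{H}}(f(X),g(Y))$, the infimum being over all metric spaces $Z$ and all isometric (distance-preserving) embeddings $f:X\to Z$, $g:Y\to Z$, with $d_{\mathrm{H}}$ the Hausdorff distance in $Z$. Equivalently $d_{\mathrm{GH}}(X,Y)=\frac12\inf_R \operatorname{dis}(R)$, where $R\subseteq X\times Y$ ranges over correspondences (relations whose projections to $X$ and to $Y$ are both surjective) and $\operatorname{dis}(R)=\sup_{(x,y),(x',y')\in R}|d_X(x,x')-d_Y(y,y')|$. *)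

theory Defs
  imports "HOL-Analysis.Analysis"
begin

section \<open>Hausdorff and Gromov-Hausdorff distance\<close>

text \<open>Real-valued, hence meaningful for nonempty sets $A$, $B$ that are bounded in $Z$.\<close>

definition hausdorff_distance :: "'c metric \<Rightarrow> 'c set \<Rightarrow> 'c set \<Rightarrow> real" where
  "hausdorff_distance Z A B =
     max (SUP a\<in>A. INF b\<in>B. mdist Z a b) (SUP b\<in>B. INF a\<in>A. mdist Z a b)"

definition isometric_embedding :: "'a metric \<Rightarrow> 'c metric \<Rightarrow> ('a \<Rightarrow> 'c) \<Rightarrow> bool" where
  "isometric_embedding X Z f \<longleftrightarrow>
     f \<in> mspace X \<rightarrow> mspace Z \<and>
     (\<forall>x\<in>mspace X. \<forall>x'\<in>mspace X. mdist Z (f x) (f x') = mdist X x x')"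

text \<open>HOL cannot quantify over the type of points of the ambient space $Z$ inside a definition.
  Points of \<open>'a + 'b\<close> suffice, since only the subspace $f(X) \cup g(Y)$ of $Z$ matters;
  \<open>gh_distance_le\<close> below shows that spaces $Z$ over any other type do not lower the infimum, and
  \<open>gh_candidates_nonempty\<close> that it is not taken over the empty set.\<close>

definition gh_candidates :: "'a metric \<Rightarrow> 'b metric \<Rightarrow> real set" where
  "gh_candidates X Y =
     {hausdorff_distance Z (f ` mspace X) (g ` mspace Y) | (Z :: ('a + 'b) metric) f g.
        isometric_embedding X Z f \<and> isometric_embedding Y Z g}"

definition gh_distance :: "'a metric \<Rightarrow> 'b metric \<Rightarrow> real" where
  "gh_distance X Y = Inf (gh_candidates X Y)"

definition bounded_metric :: "'a metric \<Rightarrow> bool" where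
  "bounded_metric X \<longleftrightarrow> Metric_space.mbounded (mspace X) (mdist X) (mspace X)"

lemma bounded_metricD:
  assumes "bounded_metric X"
  obtains B where "B > 0" "\<And>x x'. x \<in> mspace X \<Longrightarrow> x' \<in> mspace X \<Longrightarrow> mdist X x x' \<le> B"
  using assms unfolding bounded_metric_def
  by (metis Metric_space.mbounded_alt_pos Metric_space_mspace_mdist)

lemma hausdorff_distance_nonneg:
  fixes X :: "'a metric" and Y :: "'b metric" and Z :: "'c metric"
  assumes X: "bounded_metric X" "mspace X \<noteq> {}" and Y: "mspace Y \<noteq> {}"
    and f: "isometric_embedding X Z f" and g: "isometric_embedding Y Z g"
  shows "0 \<le> hausdorff_distance Z (f ` mspace X) (g ` mspace Y)"
proof -
  obtain B where B: "B > 0" "\<And>x x'. x \<in> mspace X \<Longrightarrow> x' \<in> mspace X \<Longrightarrow> mdist X x x' \<le> B"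
    using bounded_metricD[OF X(1)] by metis
  obtain x0 y0 where x0: "x0 \<in> mspace X" and y0: "y0 \<in> mspace Y"
    using X(2) Y by auto
  let ?I = "\<lambda>a. INF b\<in>g ` mspace Y. mdist Z a b"
  have bb: "bdd_below ((\<lambda>b. mdist Z a b) ` g ` mspace Y)" for a
    by (rule bdd_belowI[of _ 0]) auto
  have up: "?I (f x) \<le> B + mdist Z (f x0) (g y0)" if "x \<in> mspace X" for x
  proof -
    have "?I (f x) \<le> mdist Z (f x) (g y0)"
      using bb y0 by (intro cINF_lower) auto
    also have "\<dots> \<le> mdist Z (f x) (f x0) + mdist Z (f x0) (g y0)"
      using f g that x0 y0 by (intro mdist_triangle) (auto simp: isometric_embedding_def)
    also have "mdist Z (f x) (f x0) \<le> B"
      using f B that x0 by (auto simp: isometric_embedding_def)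
    finally show ?thesis by simp
  qed
  have "0 \<le> ?I (f x0)"
    using y0 by (intro cINF_greatest) auto
  also have "\<dots> \<le> (SUP a\<in>f ` mspace X. ?I a)"
    using x0 up by (intro cSUP_upper bdd_aboveI2) auto
  finally show ?thesis
    by (simp add: hausdorff_distance_def)
qed

lemma gh_distance_le:
  fixes X :: "'a metric" and Y :: "'b metric" and Z :: "'c metric"
  assumes X: "bounded_metric X" "mspace X \<noteq> {}" and Y: "mspace Y \<noteq> {}"
    and f: "isometric_embedding X Z f" and g: "isometric_embedding Y Z g"
  shows "gh_distance X Y \<le> hausdorff_distance Z (f ` mspace X) (g ` mspace Y)"
proof -
  define h where "h = case_sum f g"
  define M where "M = Inl ` mspace X \<union> Inr ` {y \<in> mspace Y. g y \<notin> f ` mspace X}"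
  define W where "W = metric (M, \<lambda>u v. mdist Z (h u) (h v))"
  define g' where "g' y = (if g y \<in> f ` mspace X then Inl (inv_into (mspace X) f (g y)) else Inr y)"
    for y
  have fZ: "f x \<in> mspace Z" if "x \<in> mspace X" for x
    using f that by (auto simp: isometric_embedding_def)
  have gZ: "g y \<in> mspace Z" if "y \<in> mspace Y" for y
    using g that by (auto simp: isometric_embedding_def)
  have injf: "x = x'" if "f x = f x'" "x \<in> mspace X" "x' \<in> mspace X" for x x'
    using f that fZ unfolding isometric_embedding_def by (metis mdist_zero)
  have injg: "y = y'" if "g y = g y'" "y \<in> mspace Y" "y' \<in> mspace Y" for y y'
    using g that gZ unfolding isometric_embedding_def by (metis mdist_zero)
  have hZ: "h u \<in> mspace Z" if "u \<in> M" for u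
    using that fZ gZ by (auto simp: M_def h_def)
  have injh: "u = v" if "h u = h v" "u \<in> M" "v \<in> M" for u v
    using that injf injg by (auto simp: M_def h_def) (metis imageI)+
  have MS: "Metric_space M (\<lambda>u v. mdist Z (h u) (h v))"
  proof
    show "mdist Z (h x) (h y) = 0 \<longleftrightarrow> x = y" if "x \<in> M" "y \<in> M" for x y
      using that hZ injh by (metis mdist_zero)
  qed (auto simp: mdist_commute intro: mdist_triangle hZ)
  have W: "mspace W = M" "mdist W = (\<lambda>u v. mdist Z (h u) (h v))"
    using MS by (simp_all add: W_def Metric_space.mspace_metric Metric_space.mdist_metric)
  have hg': "h (g' y) = g y" for y
    by (auto simp: h_def g'_def f_inv_into_f)
  have hf': "h (Inl x) = f x" for x
    by (simp add: h_def)
  have "isometric_embedding X W Inl"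
    using f by (auto simp: isometric_embedding_def W hf' M_def)
  moreover have "g' y \<in> M" if "y \<in> mspace Y" for y
    using that by (auto simp: g'_def M_def inv_into_into)
  then have "isometric_embedding Y W g'"
    using g by (auto simp: isometric_embedding_def W hg')
  moreover have "hausdorff_distance W (Inl ` mspace X) (g' ` mspace Y)
                 = hausdorff_distance Z (f ` mspace X) (g ` mspace Y)"
    by (simp add: hausdorff_distance_def W image_image hf' hg')
  ultimately have "hausdorff_distance Z (f ` mspace X) (g ` mspace Y) \<in> gh_candidates X Y"
    unfolding gh_candidates_def mem_Collect_eq by metis
  moreover have "bdd_below (gh_candidates X Y)"
    using hausdorff_distance_nonneg[OF X Y] by (intro bdd_belowI[of _ 0]) (auto simp: gh_candidates_def)
  ultimately show ?thesis
    unfolding gh_distance_def by (rule cInf_lower)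
qed

lemma gh_candidates_nonempty:
  fixes X :: "'a metric" and Y :: "'b metric"
  assumes "bounded_metric X" "bounded_metric Y"
  shows "gh_candidates X Y \<noteq> {}"
proof -
  obtain B where B: "B > 0" "\<And>x x'. x \<in> mspace X \<Longrightarrow> x' \<in> mspace X \<Longrightarrow> mdist X x x' \<le> B"
    using bounded_metricD[OF assms(1)] by metis
  obtain C where C: "C > 0" "\<And>x x'. x \<in> mspace Y \<Longrightarrow> x' \<in> mspace Y \<Longrightarrow> mdist Y x x' \<le> C"
    using bounded_metricD[OF assms(2)] by metis
  define d where "d u v = (case u of
      Inl x \<Rightarrow> (case v of Inl x' \<Rightarrow> mdist X x x' | Inr y' \<Rightarrow> B + C)
    | Inr y \<Rightarrow> (case v of Inl x' \<Rightarrow> B + C | Inr y' \<Rightarrow> mdist Y y y'))" for u v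
  have MS: "Metric_space (mspace X <+> mspace Y) d"
  proof
    fix x y z assume xyz: "x \<in> mspace X <+> mspace Y" "y \<in> mspace X <+> mspace Y" "z \<in> mspace X <+> mspace Y"
    show "d x z \<le> d x y + d y z"
      using xyz B C mdist_nonneg[of X] mdist_nonneg[of Y]
      by (auto simp: d_def intro: mdist_triangle; smt (verit))
  qed (use B(1) C(1) in \<open>auto simp: d_def mdist_commute split: sum.splits\<close>)
  define W where "W = metric (mspace X <+> mspace Y, d)"
  have W: "mspace W = mspace X <+> mspace Y" "mdist W = d"
    using MS by (simp_all add: W_def Metric_space.mspace_metric Metric_space.mdist_metric)
  have "isometric_embedding X W Inl" "isometric_embedding Y W Inr"
    by (auto simp: isometric_embedding_def W d_def)
  then show ?thesis
    unfolding gh_candidates_def by blast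
qed

section \<open>Spheres with the geodesic distance\<close>

text \<open>As in \<open>nsphere\<close>, a point of $R^{m+1}$ is a sequence of reals vanishing beyond index $m$, so
  that the dimension can be quantified over.  The value 0 off the sphere is irrelevant; it is
  there because the type \<open>metric\<close> wants a total nonnegative function.\<close>

definition sphere_metric :: "nat \<Rightarrow> (nat \<Rightarrow> real) metric" where
  "sphere_metric m = metric (topspace (nsphere m),
     \<lambda>x x'. if x \<in> topspace (nsphere m) \<and> x' \<in> topspace (nsphere m)
            then arccos (\<Sum>i\<le>m. x i * x' i) else 0)"

lemma topspace_nsphere_eq:
  "topspace (nsphere m) = {x. (\<Sum>i\<le>m. (x i)\<^sup>2) = 1 \<and> (\<forall>i>m. x i = 0)}"
  by (simp add: nsphere)

lemma sphere_inner_bounds: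
  fixes x y :: "nat \<Rightarrow> real"
  assumes "x \<in> topspace (nsphere m)" "y \<in> topspace (nsphere m)"
  shows "\<bar>\<Sum>i\<le>m. x i * y i\<bar> \<le> 1"
  using Cauchy_Schwarz_ineq_sum[of x y "{..m}"] assms
  by (simp add: topspace_nsphere_eq abs_square_le_1)

lemma sphere_inner_triangle:
  fixes x y z :: "nat \<Rightarrow> real"
  assumes x: "x \<in> topspace (nsphere m)" and y: "y \<in> topspace (nsphere m)"
    and z: "z \<in> topspace (nsphere m)"
  shows "arccos (\<Sum>i\<le>m. x i * z i) \<le> arccos (\<Sum>i\<le>m. x i * y i) + arccos (\<Sum>i\<le>m. y i * z i)"
proof -
  define p where "p = (\<Sum>i\<le>m. x i * y i)"
  define q where "q = (\<Sum>i\<le>m. y i * z i)"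
  define r where "r = (\<Sum>i\<le>m. x i * z i)"
  have b: "\<bar>p\<bar> \<le> 1" "\<bar>q\<bar> \<le> 1" "\<bar>r\<bar> \<le> 1"
    unfolding p_def q_def r_def using sphere_inner_bounds x y z by blast+
  have sx: "(\<Sum>i\<le>m. (x i)\<^sup>2) = 1" and sy: "(\<Sum>i\<le>m. (y i)\<^sup>2) = 1" and sz: "(\<Sum>i\<le>m. (z i)\<^sup>2) = 1"
    using x y z by (simp_all add: topspace_nsphere_eq)
  have e1: "(\<Sum>i\<le>m. (x i - p * y i) * (z i - q * y i)) = r - p * q"
  proof -
    have "(\<Sum>i\<le>m. (x i - p * y i) * (z i - q * y i))
          = (\<Sum>i\<le>m. x i * z i - q * (x i * y i) - p * (y i * z i) + p * q * (y i)\<^sup>2)"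
      by (intro sum.cong) (auto simp: algebra_simps power2_eq_square)
    also have "\<dots> = r - q * p - p * q + p * q * 1"
      by (simp add: sum.distrib sum_subtractf sum_distrib_left[symmetric] sy p_def q_def r_def)
    finally show ?thesis by simp
  qed
  have e2: "(\<Sum>i\<le>m. (x i - p * y i)\<^sup>2) = 1 - p\<^sup>2"
  proof -
    have "(\<Sum>i\<le>m. (x i - p * y i)\<^sup>2)
          = (\<Sum>i\<le>m. (x i)\<^sup>2 - 2 * p * (x i * y i) + p\<^sup>2 * (y i)\<^sup>2)"
      by (intro sum.cong) (auto simp: algebra_simps power2_eq_square)
    also have "\<dots> = 1 - 2 * p * p + p\<^sup>2 * 1"
      by (simp add: sum.distrib sum_subtractf sum_distrib_left[symmetric] sx sy p_def)
    finally show ?thesis by (simp add: power2_eq_square)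
  qed
  have e3: "(\<Sum>i\<le>m. (z i - q * y i)\<^sup>2) = 1 - q\<^sup>2"
  proof -
    have "(\<Sum>i\<le>m. (z i - q * y i)\<^sup>2)
          = (\<Sum>i\<le>m. (z i)\<^sup>2 - 2 * q * (y i * z i) + q\<^sup>2 * (y i)\<^sup>2)"
      by (intro sum.cong) (auto simp: algebra_simps power2_eq_square)
    also have "\<dots> = 1 - 2 * q * q + q\<^sup>2 * 1"
      by (simp add: sum.distrib sum_subtractf sum_distrib_left[symmetric] sz sy q_def)
    finally show ?thesis by (simp add: power2_eq_square)
  qed
  have "(r - p * q)\<^sup>2 \<le> (1 - p\<^sup>2) * (1 - q\<^sup>2)"
    using Cauchy_Schwarz_ineq_sum[of "\<lambda>i. x i - p * y i" "\<lambda>i. z i - q * y i" "{..m}"]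
    by (simp add: e1 e2 e3)
  then have "\<bar>r - p * q\<bar> \<le> sqrt (1 - p\<^sup>2) * sqrt (1 - q\<^sup>2)"
    using real_sqrt_le_mono by (fastforce simp: real_sqrt_mult)
  then have "cos (arccos p + arccos q) \<le> r"
    using b by (simp add: cos_add sin_arccos_abs cos_arccos_abs)
  show ?thesis
  proof (cases "arccos p + arccos q \<le> pi")
    case True
    have "0 \<le> arccos p + arccos q"
      using b by (intro add_nonneg_nonneg arccos_lbound) auto
    then have "arccos (cos (arccos p + arccos q)) = arccos p + arccos q"
      using True by (intro arccos_cos)
    moreover have "arccos r \<le> arccos (cos (arccos p + arccos q))"
      using \<open>cos _ \<le> r\<close> b by (intro arccos_le_arccos) auto
    ultimately show ?thesis
      by (simp add: p_def q_def r_def)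
  next
    case False
    moreover have "arccos r \<le> pi"
      using b by (intro arccos_ubound) auto
    ultimately show ?thesis
      by (simp add: p_def q_def r_def)
  qed
qed

lemma
  mspace_sphere_metric: "mspace (sphere_metric m) = topspace (nsphere m)" and
  mdist_sphere_metric: "mdist (sphere_metric m) =
     (\<lambda>x x'. if x \<in> topspace (nsphere m) \<and> x' \<in> topspace (nsphere m)
             then arccos (\<Sum>i\<le>m. x i * x' i) else 0)"
proof -
  let ?S = "topspace (nsphere m)"
  let ?d = "\<lambda>x x'. if x \<in> ?S \<and> x' \<in> ?S then arccos (\<Sum>i\<le>m. x i * x' i) else 0"
  have MS: "Metric_space ?S ?d"
  proof
    show "0 \<le> ?d x y" for x y
      using sphere_inner_bounds[of x m y] by (auto intro!: arccos_lbound)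
    show "?d x y = ?d y x" for x y
      by (simp add: mult.commute)
    show "?d x z \<le> ?d x y + ?d y z" if "x \<in> ?S" "y \<in> ?S" "z \<in> ?S" for x y z
      using that sphere_inner_triangle by simp
    show "?d x y = 0 \<longleftrightarrow> x = y" if xy: "x \<in> ?S" "y \<in> ?S" for x y
    proof
      assume "x = y"
      then show "?d x y = 0"
        using xy by (simp add: topspace_nsphere_eq power2_eq_square)
    next
      assume "?d x y = 0"
      then have "(\<Sum>i\<le>m. x i * y i) = 1"
        using xy sphere_inner_bounds[OF xy] by (metis cos_arccos_abs cos_zero)
      moreover have "(\<Sum>i\<le>m. (x i - y i)\<^sup>2)
                 = (\<Sum>i\<le>m. (x i)\<^sup>2) + (\<Sum>i\<le>m. (y i)\<^sup>2) - 2 * (\<Sum>i\<le>m. x i * y i)"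
        unfolding sum_distrib_left sum.distrib[symmetric] sum_subtractf[symmetric]
        by (intro sum.cong) (auto simp: algebra_simps power2_eq_square)
      ultimately have "(\<Sum>i\<le>m. (x i - y i)\<^sup>2) = 0"
        using xy by (simp add: topspace_nsphere_eq)
      then have "\<forall>i\<le>m. x i = y i"
        by (simp add: sum_nonneg_eq_0_iff)
      moreover have "\<forall>i>m. x i = y i"
        using xy by (simp add: topspace_nsphere_eq)
      ultimately show "x = y"
        by (metis ext not_le)
    qed
  qed
  show "mspace (sphere_metric m) = ?S" "mdist (sphere_metric m) = ?d"
    using MS by (simp_all add: sphere_metric_def Metric_space.mspace_metric Metric_space.mdist_metric)
qed

lemma sphere_metric_nonempty: "mspace (sphere_metric m) \<noteq> {}"
  unfolding mspace_sphere_metric using in_topspace_nsphere by blast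

lemma bounded_sphere_metric: "bounded_metric (sphere_metric m)"
proof -
  have "mdist (sphere_metric m) x y \<le> pi" for x y
    using sphere_inner_bounds[of x m y] by (auto simp: mdist_sphere_metric intro!: arccos_ubound)
  then show ?thesis
    unfolding bounded_metric_def
    by (metis Metric_space.mbounded_alt Metric_space_mspace_mdist order_refl)
qed

end

theory Submission
  imports Defs "HOL-Library.Ramsey"
begin

text \<open>Approximating every point of $S^n$ by a point of $S^m$ at nearly the Hausdorff distance $r$
  pulls a colouring of $S^m$ back to a colouring of $S^n$ with the same number of colours. If the
  colour classes in $S^m$ have diameter at most $\delta$, those in $S^n$ have diameter at most about
  $\delta + 2 r$ (\<open>gh_distance_ge_of_colouring\<close>). Now $S^m$, being totally bounded, has such a
  colouring for any $\delta > 0$, with a number $k$ of colours that does not depend on $n$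
  (\<open>sphere_small_colouring\<close>), whereas for $n$ large every colouring of $S^n$ with $k$ colours has
  a colour class of diameter at least $\pi - \delta$ (\<open>sphere_colouring_nearly_antipodal\<close>). Hence
  $2 r$ is at least about $\pi - 2 \delta$.

  The large colour class could be obtained from the theorem of Lyusternik and Schnirelmann. As the
  dimension $n$ may be chosen, Ramsey's theorem suffices. Assign to a set
  $a_1 < \dots < a_q$ of coordinates the unit vector with entries $+1, -1, +1, \dots$ at
  $a_1, a_2, a_3, \dots$, divided by $\sqrt q$. The vectors of $a_1 < \dots < a_q$ and of the
  shifted sequence $a_2 < \dots < a_{q+1}$ have opposite entries at the $q - 1$ common places, so
  that their inner product is $-(q-1)/q$, close to $-1$. Ramsey's theorem makes all $q$-subsets
  of some $(q+1)$-set of coordinates get vectors of the same colour, these two among them.\<close>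

section \<open>Colourings and the Gromov-Hausdorff distance\<close>

lemma hausdorff_distance_less_imp_close:
  fixes X :: "'a metric" and Y :: "'b metric" and Z :: "'c metric"
  assumes X: "mspace X \<noteq> {}" and Y: "bounded_metric Y"
    and f: "isometric_embedding X Z f" and g: "isometric_embedding Y Z g"
    and less: "hausdorff_distance Z (f ` mspace X) (g ` mspace Y) < s"
    and y: "y \<in> mspace Y"
  obtains x where "x \<in> mspace X" "mdist Z (f x) (g y) < s"
proof -
  obtain B where B: "\<And>u v. u \<in> mspace Y \<Longrightarrow> v \<in> mspace Y \<Longrightarrow> mdist Y u v \<le> B"
    using bounded_metricD[OF Y] by metis
  obtain x0 where x0: "x0 \<in> mspace X"
    using X by auto
  let ?I = "\<lambda>b. INF a\<in>f ` mspace X. mdist Z a b"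
  \<comment> \<open>The supremum of a set of reals is an upper bound only if the set is bounded.\<close>
  have up: "?I (g u) \<le> mdist Z (f x0) (g y) + B" if u: "u \<in> mspace Y" for u
  proof -
    have "?I (g u) \<le> mdist Z (f x0) (g u)"
      using x0 by (intro cINF_lower bdd_belowI[of _ 0]) auto
    also have "\<dots> \<le> mdist Z (f x0) (g y) + mdist Z (g y) (g u)"
      using f g u x0 y by (intro mdist_triangle) (auto simp: isometric_embedding_def)
    also have "mdist Z (g y) (g u) \<le> B"
      using g B y u by (auto simp: isometric_embedding_def)
    finally show ?thesis by simp
  qed
  have "?I (g y) \<le> (SUP b\<in>g ` mspace Y. ?I b)"
    using y up by (intro cSUP_upper bdd_aboveI2) auto
  also have "\<dots> < s"
    using less by (simp add: hausdorff_distance_def)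
  finally have "\<exists>a\<in>f ` mspace X. mdist Z a (g y) < s"
    using x0 by (subst (asm) cINF_less_iff) (auto intro!: bdd_belowI[of _ 0])
  then show ?thesis
    using that by auto
qed

text \<open>Colour each point of $Y$ like a point of $X$ that lies close to it in the common ambient
  space.\<close>

lemma gh_distance_ge_of_colouring:
  fixes X :: "'a metric" and Y :: "'b metric" and c :: "'a \<Rightarrow> 'k"
  assumes X: "bounded_metric X" "mspace X \<noteq> {}" and Y: "bounded_metric Y"
    and c: "c \<in> mspace X \<rightarrow> C"
    and small: "\<And>x x'. x \<in> mspace X \<Longrightarrow> x' \<in> mspace X \<Longrightarrow> c x = c x' \<Longrightarrow> mdist X x x' \<le> \<delta>"
    and large: "\<And>h. h \<in> mspace Y \<rightarrow> C \<Longrightarrow>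
                  \<exists>y\<in>mspace Y. \<exists>y'\<in>mspace Y. h y = h y' \<and> D \<le> mdist Y y y'"
  shows "(D - \<delta>) / 2 \<le> gh_distance X Y"
  unfolding gh_distance_def
proof (rule cInf_greatest)
  show "gh_candidates X Y \<noteq> {}"
    using X(1) Y by (rule gh_candidates_nonempty)
next
  fix r assume "r \<in> gh_candidates X Y"
  then obtain Z :: "('a + 'b) metric" and f g where
    r: "r = hausdorff_distance Z (f ` mspace X) (g ` mspace Y)"
    and f: "isometric_embedding X Z f" and g: "isometric_embedding Y Z g"
    unfolding gh_candidates_def by blast
  show "(D - \<delta>) / 2 \<le> r"
  proof (rule dense_ge)
    fix s assume "r < s"
    then have "\<exists>x\<in>mspace X. mdist Z (f x) (g y) < s" if "y \<in> mspace Y" for y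
      using hausdorff_distance_less_imp_close[OF X(2) Y f g _ that] r by metis
    then obtain p where p: "\<And>y. y \<in> mspace Y \<Longrightarrow> p y \<in> mspace X"
      and close: "\<And>y. y \<in> mspace Y \<Longrightarrow> mdist Z (f (p y)) (g y) < s"
      by metis
    have "(\<lambda>y. c (p y)) \<in> mspace Y \<rightarrow> C"
      using c p by auto
    then obtain y y' where y: "y \<in> mspace Y" "y' \<in> mspace Y"
      and same: "c (p y) = c (p y')" and far: "D \<le> mdist Y y y'"
      using large by blast
    have Z: "f (p y) \<in> mspace Z" "f (p y') \<in> mspace Z" "g y \<in> mspace Z" "g y' \<in> mspace Z"
      using f g p y by (auto simp: isometric_embedding_def)
    have "D \<le> mdist Z (g y) (g y')"
      using far g y by (simp add: isometric_embedding_def)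
    also have "\<dots> \<le> mdist Z (g y) (f (p y)) + (mdist Z (f (p y)) (f (p y')) + mdist Z (f (p y')) (g y'))"
      using Z by (meson add_left_mono mdist_triangle order_trans)
    also have "mdist Z (f (p y)) (f (p y')) \<le> \<delta>"
      using small[OF p p same] f p y by (simp add: isometric_embedding_def)
    finally show "(D - \<delta>) / 2 \<le> s"
      using close[OF y(1)] close[OF y(2)] by (simp add: mdist_commute)
  qed
qed

section \<open>Colourings of the sphere with small classes\<close>

text \<open>The colour of a point is the cell of a cubical grid in which it lies.\<close>

lemma sphere_small_colouring:
  fixes m :: nat and e :: real
  assumes e: "0 < e" "e \<le> pi"
  obtains k :: nat and c where "c \<in> mspace (sphere_metric m) \<rightarrow> {..<k}"
    and "\<And>x x'. x \<in> mspace (sphere_metric m) \<Longrightarrow> x' \<in> mspace (sphere_metric m) \<Longrightarrow>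
           c x = c x' \<Longrightarrow> mdist (sphere_metric m) x x' \<le> e"
proof -
  let ?S = "mspace (sphere_metric m)"
  have cos_e: "cos e < 1"
    using e cos_monotone_0_pi[of 0 e] by simp
  \<comment> \<open>Two unit vectors at distance at most \<open>t\<close> in each coordinate have inner product at least
    $1 - (m+1) t^2 / 2 = \cos e$.\<close>
  define t where "t = sqrt (2 * (1 - cos e) / (m + 1))"
  have t: "t > 0" "t\<^sup>2 * (m + 1) = 2 * (1 - cos e)"
    using cos_e by (simp_all add: t_def field_simps)
  define cell where "cell x = restrict (\<lambda>i. \<lfloor>x i / t\<rfloor>) {..m}" for x :: "nat \<Rightarrow> real"
  define K where "K = PiE {..m} (\<lambda>_. {\<lfloor>- 1 / t\<rfloor>..\<lfloor>1 / t\<rfloor>})"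
  have cell_K: "cell x \<in> K" if x: "x \<in> ?S" for x
  proof -
    have "\<bar>x i\<bar> \<le> 1" if "i \<le> m" for i
    proof -
      have "(x i)\<^sup>2 \<le> (\<Sum>i\<le>m. (x i)\<^sup>2)"
        using that by (intro member_le_sum) auto
      then show ?thesis
        using x by (simp add: mspace_sphere_metric topspace_nsphere_eq abs_square_le_1)
    qed
    then have "- 1 / t \<le> x i / t" "x i / t \<le> 1 / t" if "i \<le> m" for i
      using t(1) that by (intro divide_right_mono; force simp: abs_le_iff)+
    then show ?thesis
      by (auto simp: K_def cell_def intro!: floor_mono)
  qed
  have small: "mdist (sphere_metric m) x y \<le> e"
    if x: "x \<in> ?S" and y: "y \<in> ?S" and same: "cell x = cell y" for x y
  proof -
    have "(x i - y i)\<^sup>2 \<le> t\<^sup>2" if "i \<le> m" for i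
    proof -
      have "\<lfloor>x i / t\<rfloor> = \<lfloor>y i / t\<rfloor>"
        using same that by (metis atMost_iff cell_def restrict_apply')
      then have "\<bar>x i / t - y i / t\<bar> < 1"
        by linarith
      then have "\<bar>x i - y i\<bar> \<le> \<bar>t\<bar>"
        using t(1) by (simp add: diff_divide_distrib[symmetric] abs_divide)
      then show ?thesis
        by (simp add: abs_le_square_iff)
    qed
    then have "(\<Sum>i\<le>m. (x i - y i)\<^sup>2) \<le> (\<Sum>i\<le>m. t\<^sup>2)"
      by (intro sum_mono) auto
    also have "\<dots> = 2 * (1 - cos e)"
      using t(2) by (simp add: algebra_simps)
    finally have "(\<Sum>i\<le>m. (x i - y i)\<^sup>2) \<le> 2 * (1 - cos e)" .
    moreover have "(\<Sum>i\<le>m. (x i - y i)\<^sup>2)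
        = (\<Sum>i\<le>m. (x i)\<^sup>2) + (\<Sum>i\<le>m. (y i)\<^sup>2) - 2 * (\<Sum>i\<le>m. x i * y i)"
      unfolding sum_distrib_left sum.distrib[symmetric] sum_subtractf[symmetric]
      by (intro sum.cong) (auto simp: algebra_simps power2_eq_square)
    ultimately have "cos e \<le> (\<Sum>i\<le>m. x i * y i)"
      using x y by (simp add: mspace_sphere_metric topspace_nsphere_eq)
    then have "arccos (\<Sum>i\<le>m. x i * y i) \<le> arccos (cos e)"
      using sphere_inner_bounds[of x m y] x y
      by (intro arccos_le_arccos) (auto simp: mspace_sphere_metric)
    then show ?thesis
      using e x y by (simp add: mdist_sphere_metric mspace_sphere_metric arccos_cos)
  qed
  have "finite K"
    by (simp add: K_def finite_PiE)
  then obtain b where b: "bij_betw b K {0..<card K}"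
    using ex_bij_betw_finite_nat by blast
  show ?thesis
  proof
    show "(\<lambda>x. b (cell x)) \<in> ?S \<rightarrow> {..<card K}"
      using b cell_K by (force dest: bij_betwE)
    show "mdist (sphere_metric m) x x' \<le> e"
      if "x \<in> ?S" "x' \<in> ?S" "b (cell x) = b (cell x')" for x x'
      using that b cell_K small by (metis bij_betw_imp_inj_on inj_onD)
  qed
qed

section \<open>Nearly antipodal points of the same colour\<close>

definition alternating_vector :: "nat set \<Rightarrow> nat \<Rightarrow> real" where
  "alternating_vector A i =
     (if i \<in> A then (- 1) ^ card {a \<in> A. a < i} / sqrt (card A) else 0)"

lemma alternating_vector_in_sphere:
  assumes "A \<subseteq> {..n}" "A \<noteq> {}"
  shows "alternating_vector A \<in> topspace (nsphere n)"
proof -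
  have fin: "finite A"
    using assms finite_subset by blast
  have "(\<Sum>i\<le>n. (alternating_vector A i)\<^sup>2) = (\<Sum>i\<in>A. (alternating_vector A i)\<^sup>2)"
    using assms by (intro sum.mono_neutral_right) (auto simp: alternating_vector_def)
  also have "\<dots> = (\<Sum>i\<in>A. 1 / card A)"
    by (intro sum.cong) (auto simp: alternating_vector_def power_divide power2_eq_square
        simp flip: power_mult_distrib)
  also have "\<dots> = 1"
    using assms fin by simp
  finally show ?thesis
    using assms by (auto simp: topspace_nsphere_eq alternating_vector_def)
qed

text \<open>Deleting the least element of \<open>H\<close> lowers by one the number of elements below any other
  element, and so reverses its sign; deleting the greatest element has no such effect.\<close>

lemma inner_alternating_vector_shift:
  fixes H :: "nat set"
  assumes H: "H \<subseteq> {..n}" "card H = Suc q" and q: "q > 0"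
  shows "(\<Sum>i\<le>n. alternating_vector (H - {Max H}) i * alternating_vector (H - {Min H}) i)
         = - (1 - 1 / q)"
proof -
  define A B I where "A = H - {Max H}" and "B = H - {Min H}" and "I = H - {Max H, Min H}"
  have fin: "finite H" and ne: "H \<noteq> {}"
    using H finite_subset by auto
  have mem: "Max H \<in> H" "Min H \<in> H"
    using fin ne by auto
  have neq: "Max H \<noteq> Min H"
  proof
    assume eq: "Max H = Min H"
    have "H \<subseteq> {Min H}"
      using Max_ge[OF fin] Min_le[OF fin] eq by (auto intro: antisym)
    then have "card H \<le> 1"
      using card_mono[of "{Min H}" H] by simp
    then show False
      using H q by simp
  qed
  have card: "card A = q" "card B = q" "card I = q - 1"
    using fin mem neq H by (simp_all add: A_def B_def I_def card_Diff_subset)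
  have opposite: "alternating_vector A i * alternating_vector B i = - (1 / q)" if i: "i \<in> I" for i
  proof -
    have "Min H < i" "i < Max H"
      using i fin by (auto simp: I_def order_less_le)
    then have "{a \<in> A. a < i} = insert (Min H) {b \<in> B. b < i}" and "Min H \<notin> {b \<in> B. b < i}"
      using mem by (auto simp: A_def B_def)
    moreover have "finite {b \<in> B. b < i}"
      using fin by (simp add: B_def)
    ultimately have "card {a \<in> A. a < i} = Suc (card {b \<in> B. b < i})"
      by simp
    moreover have "i \<in> A" "i \<in> B"
      using i by (auto simp: A_def B_def I_def)
    ultimately show ?thesis
      by (simp add: alternating_vector_def card flip: power_mult_distrib)
  qed
  have "(\<Sum>i\<le>n. alternating_vector A i * alternating_vector B i)
      = (\<Sum>i\<in>I. alternating_vector A i * alternating_vector B i)"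
    using H by (intro sum.mono_neutral_right) (auto simp: A_def B_def I_def alternating_vector_def)
  also have "\<dots> = (\<Sum>i\<in>I. - (1 / q))"
    by (intro sum.cong) (auto simp: opposite)
  also have "\<dots> = - (1 - 1 / q)"
    using q by (simp add: card of_nat_diff field_simps)
  finally show ?thesis
    by (simp add: A_def B_def)
qed

lemma sphere_colouring_nearly_antipodal:
  fixes k :: nat and e :: real
  assumes e: "0 < e" "e \<le> pi"
  obtains N where "\<And>n h. n \<ge> N \<Longrightarrow> h \<in> mspace (sphere_metric n) \<rightarrow> {..<k} \<Longrightarrow>
    \<exists>x\<in>mspace (sphere_metric n). \<exists>y\<in>mspace (sphere_metric n).
      h x = h y \<and> pi - e \<le> mdist (sphere_metric n) x y"
proof -
  have cos_e: "cos e < 1"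
    using e cos_monotone_0_pi[of 0 e] by simp
  then obtain q :: nat where q: "q > 0" "1 / q < 1 - cos e"
    using ex_inverse_of_nat_less[of "1 - cos e"] by (auto simp: inverse_eq_divide)
  obtain N :: nat where N: "partn_lst {..<N} (replicate k (Suc q)) q"
    using ramsey_full by blast
  show ?thesis
  proof
    fix n and h :: "(nat \<Rightarrow> real) \<Rightarrow> nat"
    let ?S = "mspace (sphere_metric n)"
    assume n: "n \<ge> N" and h: "h \<in> ?S \<rightarrow> {..<k}"
    have sphere: "alternating_vector A \<in> ?S" if "A \<subseteq> {..n}" "card A = q" for A
      using that q(1) alternating_vector_in_sphere[of A n] card.empty
      by (metis less_irrefl mspace_sphere_metric)
    have "(\<lambda>A. h (alternating_vector A)) \<in> [{..<N}]\<^bsup>q\<^esup> \<rightarrow> {..<k}"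
    proof
      fix A assume "A \<in> [{..<N}]\<^bsup>q\<^esup>"
      then have "A \<subseteq> {..n}" "card A = q"
        using n by (auto simp: nsets_def)
      then show "h (alternating_vector A) \<in> {..<k}"
        using h sphere by blast
    qed
    then obtain i H where i: "i < k" and "H \<in> [{..<N}]\<^bsup>(replicate k (Suc q) ! i)\<^esup>"
      and mono: "(\<lambda>A. h (alternating_vector A)) ` [H]\<^bsup>q\<^esup> \<subseteq> {i}"
      using partn_lstE[OF N] by (metis length_replicate)
    then have H: "H \<subseteq> {..n}" "card H = Suc q" and fin: "finite H"
      using n by (auto simp: nsets_def)
    define A B where "A = H - {Max H}" and "B = H - {Min H}"
    have "H \<noteq> {}"
      using H by auto
    then have AB: "A \<in> [H]\<^bsup>q\<^esup>" "B \<in> [H]\<^bsup>q\<^esup>"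
      using H fin by (auto simp: A_def B_def nsets_def)
    then have S: "alternating_vector A \<in> ?S" "alternating_vector B \<in> ?S"
      using H sphere by (auto simp: nsets_def)
    have "h (alternating_vector A) = h (alternating_vector B)"
      using mono AB by blast
    moreover have "pi - e \<le> mdist (sphere_metric n) (alternating_vector A) (alternating_vector B)"
    proof -
      have "pi - e = arccos (cos (pi - e))"
        using e by (intro arccos_cos[symmetric]) auto
      also have "\<dots> \<le> arccos (- (1 - 1 / q))"
        using q cos_e by (intro arccos_le_arccos) (auto simp: field_simps)
      also have "\<dots> = mdist (sphere_metric n) (alternating_vector A) (alternating_vector B)"
        using S inner_alternating_vector_shift[OF H q(1)]
        by (simp add: mdist_sphere_metric mspace_sphere_metric A_def B_def)
      finally show ?thesis .
    qed
    ultimately show "\<exists>x\<in>?S. \<exists>y\<in>?S. h x = h y \<and> pi - e \<le> mdist (sphere_metric n) x y"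
      using S by blast
  qed
qed

section \<open>Distances between spheres\<close>

theorem corollary1p10:
  fixes m :: nat and \<epsilon> :: real
  assumes "m > 0" and "\<epsilon> > 0"
  shows "\<exists>n::nat. n > m \<and> gh_distance (sphere_metric m) (sphere_metric n) \<ge> pi / 2 - \<epsilon>"
proof -
  define e where "e = min \<epsilon> pi"
  have e: "0 < e" "e \<le> pi" "e \<le> \<epsilon>"
    using assms by (auto simp: e_def)
  obtain k :: nat and c where c: "c \<in> mspace (sphere_metric m) \<rightarrow> {..<k}"
    and small: "\<And>x x'. x \<in> mspace (sphere_metric m) \<Longrightarrow> x' \<in> mspace (sphere_metric m) \<Longrightarrow>
                  c x = c x' \<Longrightarrow> mdist (sphere_metric m) x x' \<le> e"
    using sphere_small_colouring[OF e(1,2)] by metis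
  obtain N where large: "\<And>n h. n \<ge> N \<Longrightarrow> h \<in> mspace (sphere_metric n) \<rightarrow> {..<k} \<Longrightarrow>
    \<exists>x\<in>mspace (sphere_metric n). \<exists>y\<in>mspace (sphere_metric n).
      h x = h y \<and> pi - e \<le> mdist (sphere_metric n) x y"
    using sphere_colouring_nearly_antipodal[OF e(1,2)] by metis
  define n where "n = max N (Suc m)"
  have "((pi - e) - e) / 2 \<le> gh_distance (sphere_metric m) (sphere_metric n)"
    using bounded_sphere_metric sphere_metric_nonempty bounded_sphere_metric c small
    by (rule gh_distance_ge_of_colouring) (auto simp: n_def intro!: large)
  then show ?thesis
    using e(3) by (intro exI[of _ n]) (auto simp: n_def field_simps)
qed

end
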